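(* The $\mathbb S$-module $\mathbb G=\{\mathbb G(n)\}_{n\ge 0}$ of cooperative games, equipped with the partial composition maps $$\circ_i:\mathbb G(n)\times\mathbb G(m)\longrightarrow \mathbb G(n+m-1),\qquad (\Gamma_1,\Gamma_2)\longmapsto \Gamma_1\circ_i\Gamma_2,\qquad 1\le i\le n,$$ and with the unit map $\eta:\mathbb R\to\mathbb G(1)$ sending $1$ to the trivial game $\mathbf 1$, is a unital partial operad in real vector spaces.
   Context: An $n$-player game is a pair $\Gamma=(N,v)$ with $N$ a totally ordered set of $n$ players and $v:\mathcal P(N)\to\mathbb R$ a function; all games are assumed grounded, i.e. $v(\emptyset)=0$. $\mathbb G(n)$ is the real vector space (pointwise operations) of all games on $[n]=\{1,\dots,n\}$ (so $\mathbb G(0)=0$); $\mathbb S_n$ acts on it by $(\sigma\star v)(S)=v(\sigma^{-1}(S))$. The trivial game $\mathbf 1$ is the $1$-player game with value $1$ on its player. Partial composition: for games $\Gamma_A=(A,\alpha)$ and $\Gamma_B=(B,\beta)$ with disjoint nonempty player sets and $i\in A$ (identified with the $i$-th player), let $A\diamond_i B=(A\setminus\{i\})\cup B$, totally ordered by inserting $B$, with its own order, in the place of $i$. Then $\Gamma_A\circ_i\Gamma_B=(A\diamond_iB,\alpha\circ_i\beta)$ with $$(\alpha\circ_i\beta)(S)=\beta(B)\,\alpha(S_A)+\partial_i\alpha(S_A)\,\beta(S_B),\qquad S_A=S\cap A,\ S_B=S\cap B,$$ where $\partial_i\alpha(S)=\alpha(S\cup\{i\})-\alpha(S\setminus\{i\})$.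 Games on an $n$-element totally ordered set are identified with games on $[n]$ by the order isomorphism. (Since $\mathbb G(0)=0$, compositions involving arity $0$ are zero.) A unital partial operad is a family $\{P(n)\}_{n\ge0}$ of $\mathbb S_n$-modules (left actions written $\star$) with bilinear maps $\circ_i:P(n)\times P(m)\to P(n+m-1)$, $1\le i\le n$, and a linear map $\eta:\mathbb R\to P(1)$, such that for $\lambda\in P(p),\mu\in P(q),\nu\in P(r)$: (1) sequential axiom: $(\lambda\circ_i\mu)\circ_{i+j-1}\nu=\lambda\circ_i(\mu\circ_j\nu)$ for $i\in[p]$, $j\in[q]$; (2) parallel axiom: $(\lambda\circ_i\mu)\circ_{k+q-1}\nu=(\lambda\circ_k\nu)\circ_i\mu$ for $1\le i<k\le p$; (3) $\lambda\circ_i(\sigma\star\mu)=\sigma'\star(\lambda\circ_i\mu)$ for $\sigma\in\mathbb S_q$, where $\sigma'\in\mathbb S_{p+q-1}$ acts as $\sigma$ on the block $\{i,\dots,i+q-1\}$ and as the identity elsewhere; (4) $(\tau\star\lambda)\circ_{\tau(i)}\mu=\tau'\star(\lambda\circ_i\mu)$ for $\tau\in\mathbb S_p$, where $\tau'\in\mathbb S_{p+q-1}$ is the block permutation: divide $[p+q-1]$ into $p$ consecutive blocks, all of size $1$ except the $i$-th, of size $q$; $\tau'$ permutes the blocks according to $\tau$, keeping the order inside the block of size $q$ (so that block goes to $\{\tau(i),\dots,\tau(i)+q-1\}$); (5) $\mu\circ_i\eta(1)=\mu$ and $\eta(1)\circ_1\mu=\mu$. *)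

theory Defs
  imports "HOL-Algebra.Algebra" "HOL-Algebra.Algebraic_Closure_Type"
begin

section \<open>Unital partial operads in real vector spaces\<close>

text \<open>Real vector spaces are modules over the field of real numbers.\<close>

abbreviation real_field :: "real ring" where
  "real_field \<equiv> ring_of_type_algebra"

definition real_line :: "(real, real) module" where
  "real_line = ring.extend real_field (module.fields (*))"

definition linear_maps ::
    "(real, 'a, 'm) module_scheme \<Rightarrow> (real, 'b, 'n) module_scheme \<Rightarrow> ('a \<Rightarrow> 'b) set" where
  "linear_maps V W = {f \<in> carrier V \<rightarrow> carrier W.
     (\<forall>x\<in>carrier V. \<forall>y\<in>carrier V. f (x \<oplus>\<^bsub>V\<^esub> y) = f x \<oplus>\<^bsub>W\<^esub> f y) \<and>
     (\<forall>c. \<forall>x\<in>carrier V. f (c \<odot>\<^bsub>V\<^esub> x) = c \<odot>\<^bsub>W\<^esub> f x)}"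

definition bilinear_maps ::
    "(real, 'a, 'm) module_scheme \<Rightarrow> (real, 'b, 'n) module_scheme \<Rightarrow> (real, 'c, 'k) module_scheme
      \<Rightarrow> ('a \<Rightarrow> 'b \<Rightarrow> 'c) set" where
  "bilinear_maps U V W = {f.
     (\<forall>x\<in>carrier U. f x \<in> linear_maps V W) \<and>
     (\<forall>y\<in>carrier V. (\<lambda>x. f x y) \<in> linear_maps U W)}"

text \<open>
  \<open>inner_perm i q \<sigma>\<close> acts as \<open>\<sigma>\<close> on the block \<open>{i, \<dots>, i + q - 1}\<close> (which is empty for
  \<open>q = 0\<close>) and as the identity elsewhere.
\<close>

definition inner_perm :: "nat \<Rightarrow> nat \<Rightarrow> (nat \<Rightarrow> nat) \<Rightarrow> nat \<Rightarrow> nat" where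
  "inner_perm i q \<sigma> x = (if x \<in> {i..<i + q} then \<sigma> (x + 1 - i) + (i - 1) else x)"

text \<open>
  Consecutive blocks numbered \<open>1, 2, \<dots>\<close>, the \<open>k\<close>-th one having size \<open>s k\<close>. The block
  permutation sends the \<open>k\<close>-th block, in increasing order, to the \<open>\<tau> k\<close>-th block of the
  division whose block sizes are permuted accordingly.
\<close>

definition block_offset :: "(nat \<Rightarrow> nat) \<Rightarrow> nat \<Rightarrow> nat" where
  "block_offset s k = (\<Sum>l\<in>{1..<k}. s l)"

definition block :: "(nat \<Rightarrow> nat) \<Rightarrow> nat \<Rightarrow> nat set" where
  "block s k = {block_offset s k <.. block_offset s k + s k}"

definition block_perm :: "nat \<Rightarrow> (nat \<Rightarrow> nat) \<Rightarrow> (nat \<Rightarrow> nat) \<Rightarrow> nat \<Rightarrow> nat" where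
  "block_perm p s \<tau> x =
     (if \<exists>k\<in>{1..p}. x \<in> block s k
      then let k = (THE k. k \<in> {1..p} \<and> x \<in> block s k)
           in block_offset (s \<circ> inv' \<tau>) (\<tau> k) + (x - block_offset s k)
      else x)"

locale S_module =
  fixes P :: "nat \<Rightarrow> (real, 'a) module"
    and act :: "nat \<Rightarrow> (nat \<Rightarrow> nat) \<Rightarrow> 'a \<Rightarrow> 'a"
  assumes vector_space: "module real_field (P n)"
    and action: "group_action (sym_group n) (carrier (P n)) (act n)"
    and act_linear: "\<sigma> \<in> carrier (sym_group n) \<Longrightarrow> act n \<sigma> \<in> linear_maps (P n) (P n)"

text \<open>
  \<open>circ n m i\<close> is the partial composition \<open>P(n) \<times> P(m) \<rightarrow> P(n + m - 1)\<close>. It is only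
  constrained for \<open>1 \<le> i \<le> n\<close>, so that the truncated subtraction is harmless.
\<close>

locale unital_partial_operad = S_module P act
  for P :: "nat \<Rightarrow> (real, 'a) module"
    and act :: "nat \<Rightarrow> (nat \<Rightarrow> nat) \<Rightarrow> 'a \<Rightarrow> 'a" +
  fixes circ :: "nat \<Rightarrow> nat \<Rightarrow> nat \<Rightarrow> 'a \<Rightarrow> 'a \<Rightarrow> 'a"
    and \<eta> :: "real \<Rightarrow> 'a"
  assumes circ_bilinear:
      "i \<in> {1..n} \<Longrightarrow> circ n m i \<in> bilinear_maps (P n) (P m) (P (n + m - 1))"
    and unit_linear: "\<eta> \<in> linear_maps real_line (P 1)"
    and sequential:
      "\<lbrakk>l \<in> carrier (P p); u \<in> carrier (P q); v \<in> carrier (P r); i \<in> {1..p}; j \<in> {1..q}\<rbrakk>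
        \<Longrightarrow> circ (p + q - 1) r (i + j - 1) (circ p q i l u) v
            = circ p (q + r - 1) i l (circ q r j u v)"
    and parallel:
      "\<lbrakk>l \<in> carrier (P p); u \<in> carrier (P q); v \<in> carrier (P r); 1 \<le> i; i < k; k \<le> p\<rbrakk>
        \<Longrightarrow> circ (p + q - 1) r (k + q - 1) (circ p q i l u) v
            = circ (p + r - 1) q i (circ p r k l v) u"
    and equivariant_inner:
      "\<lbrakk>l \<in> carrier (P p); u \<in> carrier (P q); i \<in> {1..p}; \<sigma> \<in> carrier (sym_group q)\<rbrakk>
        \<Longrightarrow> circ p q i l (act q \<sigma> u) = act (p + q - 1) (inner_perm i q \<sigma>) (circ p q i l u)"
    and equivariant_outer:
      "\<lbrakk>l \<in> carrier (P p); u \<in> carrier (P q); i \<in> {1..p}; \<tau> \<in> carrier (sym_group p)\<rbrakk>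
        \<Longrightarrow> circ p q (\<tau> i) (act p \<tau> l) u
            = act (p + q - 1) (block_perm p (\<lambda>k. if k = i then q else 1) \<tau>) (circ p q i l u)"
    and unit_right: "\<lbrakk>u \<in> carrier (P n); i \<in> {1..n}\<rbrakk> \<Longrightarrow> circ n 1 i u (\<eta> 1) = u"
    and unit_left: "u \<in> carrier (P n) \<Longrightarrow> circ 1 n 1 (\<eta> 1) u = u"

section \<open>Cooperative games\<close>

text \<open>
  Players are ordered by the (reflexive) relation \<open>prec\<close>. The function \<open>worth\<close> has the power
  set of the players as its domain; following \<^theory>\<open>HOL-Library.FuncSet\<close>, it is
  \<open>undefined\<close> elsewhere, so that equality of games is equality of functions.
\<close>

record 'a game =
  players :: "'a set"
  prec :: "'a rel"
  worth :: "'a set \<Rightarrow> real"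

definition is_game :: "'a game \<Rightarrow> bool" where
  "is_game G \<longleftrightarrow> finite (players G) \<and> linear_order_on (players G) (prec G) \<and>
     worth G \<in> Pow (players G) \<rightarrow>\<^sub>E UNIV \<and> worth G {} = 0"

definition marginal :: "'a \<Rightarrow> ('a set \<Rightarrow> real) \<Rightarrow> 'a set \<Rightarrow> real" where
  "marginal i \<alpha> S = \<alpha> (S \<union> {i}) - \<alpha> (S - {i})"

text \<open>
  The composition is meant for games with disjoint player sets and \<open>i \<in> players A\<close>. If
  \<open>B\<close> has no players, the result has worth 0, since \<open>B\<close> is grounded.
\<close>

definition game_comp :: "'a game \<Rightarrow> 'a \<Rightarrow> 'a game \<Rightarrow> 'a game" where
  "game_comp A i B =
     \<lparr>players = (players A - {i}) \<union> players B,
      prec = {(x, y). x \<in> players A - {i} \<and> y \<in> players A - {i} \<and> (x, y) \<in> prec A}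
           \<union> {(x, y). x \<in> players B \<and> y \<in> players B \<and> (x, y) \<in> prec B}
           \<union> {(x, y). x \<in> players A - {i} \<and> y \<in> players B \<and> (x, i) \<in> prec A}
           \<union> {(x, y). x \<in> players B \<and> y \<in> players A - {i} \<and> (i, y) \<in> prec A},
      worth = (\<lambda>S\<in>Pow ((players A - {i}) \<union> players B).
        worth B (players B) * worth A (S \<inter> players A)
          + marginal i (worth A) (S \<inter> players A) * worth B (S \<inter> players B))\<rparr>"

definition relabel :: "('a \<Rightarrow> 'b) \<Rightarrow> 'a game \<Rightarrow> 'b game" where
  "relabel f G =
     \<lparr>players = f ` players G,
      prec = map_prod f f ` prec G,
      worth = (\<lambda>S\<in>Pow (f ` players G). worth G {x \<in> players G. f x \<in> S})\<rparr>"

definition rank :: "'a game \<Rightarrow> 'a \<Rightarrow> nat" where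
  "rank G x = card {y \<in> players G. (y, x) \<in> prec G}"

text \<open>The rank function is the order isomorphism from the players onto \<open>{1..n}\<close>.\<close>

lemma rank_order_iso:
  assumes "is_game G"
  shows "bij_betw (rank G) (players G) {1..card (players G)}"
    and "\<lbrakk>x \<in> players G; y \<in> players G\<rbrakk> \<Longrightarrow> (x, y) \<in> prec G \<longleftrightarrow> rank G x \<le> rank G y"
proof -
  let ?N = "players G" and ?r = "prec G"
  let ?D = "\<lambda>x. {y \<in> ?N. (y, x) \<in> ?r}"
  have fin: "finite ?N" and lin: "linear_order_on ?N ?r"
    using assms by (auto simp: is_game_def)
  have refl: "x \<in> ?N \<Longrightarrow> (x, x) \<in> ?r" for x
    using lin by (auto simp: order_on_defs refl_on_def)
  have trans: "(x, y) \<in> ?r \<Longrightarrow> (y, z) \<in> ?r \<Longrightarrow> (x, z) \<in> ?r" for x y z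
    using lin unfolding order_on_defs by (meson transD)
  have antisym: "(x, y) \<in> ?r \<Longrightarrow> (y, x) \<in> ?r \<Longrightarrow> x = y" for x y
    using lin unfolding order_on_defs by (meson antisymD)
  have total: "x \<in> ?N \<Longrightarrow> y \<in> ?N \<Longrightarrow> (x, y) \<in> ?r \<or> (y, x) \<in> ?r" for x y
    using lin refl unfolding order_on_defs total_on_def by metis
  have less: "rank G x < rank G y" if "x \<in> ?N" "y \<in> ?N" "(x, y) \<in> ?r" "x \<noteq> y" for x y
  proof -
    have "y \<in> ?D y" "y \<notin> ?D x" "?D x \<subseteq> ?D y"
      using that refl trans antisym by blast+
    then show ?thesis
      using fin unfolding rank_def by (intro psubset_card_mono) auto
  qed
  show iff: "(x, y) \<in> ?r \<longleftrightarrow> rank G x \<le> rank G y" if "x \<in> ?N" "y \<in> ?N" for x y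
    using that less[of x y] less[of y x] total[of x y] refl[of x] by fastforce
  have inj: "inj_on (rank G) ?N"
    using iff antisym by (intro inj_onI) (metis order_refl)
  have "rank G ` ?N \<subseteq> {1..card ?N}"
  proof
    fix n assume "n \<in> rank G ` ?N"
    then obtain x where "x \<in> ?N" "n = rank G x" by blast
    moreover have "?D x \<noteq> {}" using \<open>x \<in> ?N\<close> refl by blast
    ultimately show "n \<in> {1..card ?N}"
      using fin by (auto simp: rank_def Suc_le_eq card_gt_0_iff intro: card_mono)
  qed
  then have "rank G ` ?N = {1..card ?N}"
    using inj by (intro card_subset_eq) (auto simp: card_image)
  then show "bij_betw (rank G) ?N {1..card ?N}"
    using inj by (simp add: bij_betw_def)
qed

definition interval_game :: "nat \<Rightarrow> (nat set \<Rightarrow> real) \<Rightarrow> nat game" where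
  "interval_game n v =
     \<lparr>players = {1..n}, prec = {(x, y). x \<in> {1..n} \<and> y \<in> {1..n} \<and> x \<le> y}, worth = v\<rparr>"

text \<open>
  The ring multiplication of the \<open>module\<close> record is irrelevant for vector spaces and left
  \<open>undefined\<close>.
\<close>

definition games :: "nat \<Rightarrow> (real, nat set \<Rightarrow> real) module" where
  "games n =
     \<lparr>carrier = {v. is_game (interval_game n v)},
      monoid.mult = undefined,
      one = undefined,
      ring.zero = (\<lambda>S\<in>Pow {1..n}. 0),
      add = (\<lambda>v w. \<lambda>S\<in>Pow {1..n}. v S + w S),
      module.smult = (\<lambda>c v. \<lambda>S\<in>Pow {1..n}. c * v S)\<rparr>"

definition games_act ::
    "nat \<Rightarrow> (nat \<Rightarrow> nat) \<Rightarrow> (nat set \<Rightarrow> real) \<Rightarrow> (nat set \<Rightarrow> real)" where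
  "games_act n \<sigma> = (\<lambda>v\<in>carrier (games n). \<lambda>S\<in>Pow {1..n}. v (\<sigma> -` S))"

text \<open>
  The two player sets \<open>{1..n}\<close> and \<open>{1..m}\<close> are first made disjoint; the composite is then
  transported to \<open>{1..n + m - 1}\<close> along the order isomorphism.
\<close>

definition games_circ ::
    "nat \<Rightarrow> nat \<Rightarrow> nat \<Rightarrow> (nat set \<Rightarrow> real) \<Rightarrow> (nat set \<Rightarrow> real) \<Rightarrow> (nat set \<Rightarrow> real)" where
  "games_circ n m i \<alpha> \<beta> =
     (let C = game_comp (relabel Inl (interval_game n \<alpha>)) (Inl i)
                (relabel Inr (interval_game m \<beta>)) :: (nat + nat) game
      in worth (relabel (rank C) C))"

definition trivial_game :: "nat set \<Rightarrow> real" where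
  "trivial_game = (\<lambda>S\<in>Pow {1}. if S = {1} then 1 else 0)"

definition games_unit :: "real \<Rightarrow> (nat set \<Rightarrow> real)" where
  "games_unit c = c \<odot>\<^bsub>games 1\<^esub> trivial_game"

end

theory Submission
  imports Defs
begin

text \<open>
  Composing at player \<open>i\<close> replaces the position \<open>i\<close> in \<open>{1..n}\<close> by a block of \<open>m\<close>
  positions. A coalition \<open>S\<close> of the composite is therefore the same as a pair \<open>(A, B)\<close>, where
  \<open>A \<subseteq> {1..n} - {i}\<close> collects the outer players and \<open>B \<subseteq> {1..m}\<close> the inner players of \<open>S\<close>.
  Computing the order isomorphism (\<open>rank_eqI\<close>, \<open>pos_le_pos_iff\<close>) turns the definition of the
  composite into the closed formula of \<open>games_circ_formula\<close>,
  \<open>(\<alpha> \<circ>\<^sub>i \<beta>)(S) = \<beta>([m]) * \<alpha>(A) + (\<alpha>(A \<union> {i}) - \<alpha>(A)) * \<beta>(B)\<close>, where \<open>[m] = {1..m}\<close>.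
  It is bilinear in \<open>(\<alpha>, \<beta>)\<close>. For each remaining axiom it suffices to check that both sides
  cut \<open>S\<close> into the same pieces, which is arithmetic of positions, and then to compare the worths.

  Iterating the formula asks for the total worth or for a marginal contribution of the composite
  that was formed first. In the sequential case the total worth is
  multiplicative, \<open>(\<mu> \<circ>\<^sub>j \<nu>)([q + r - 1]) = \<mu>([q]) * \<nu>([r])\<close>, and the marginal of \<open>\<lambda> \<circ>\<^sub>i \<mu>\<close> at
  the player \<open>j\<close> of \<open>\<mu>\<close> is the product of the marginal of \<open>\<lambda>\<close> at \<open>i\<close> and that of \<open>\<mu>\<close> at \<open>j\<close>.
  In the parallel case both sides expand to the same expression in \<open>\<lambda>(A)\<close>, the two first
  differences of \<open>\<lambda>\<close> at \<open>i\<close> and \<open>k\<close>, and its second difference, which does not depend on the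
  order of \<open>i\<close> and \<open>k\<close>.

  Both equivariance axioms are instances of one statement (\<open>games_circ_equivariant\<close>): if \<open>\<tau>\<close> and
  \<open>\<sigma>\<close> act on the outer and the inner players, and \<open>\<pi>\<close> is the map that they induce on positions,
  then composition intertwines the two actions.
\<close>

section \<open>The vector space of games and its symmetric group action\<close>

lemma carrier_games: "v \<in> carrier (games n) \<longleftrightarrow> v \<in> extensional (Pow {1..n}) \<and> v {} = 0"
proof -
  have "linear_order_on {1..n} {(x, y). x \<in> {1..n} \<and> y \<in> {1..n} \<and> x \<le> y}"
    by (auto simp: order_on_defs refl_on_def trans_def antisym_def total_on_def)
  then show ?thesis
    by (auto simp: games_def is_game_def interval_game_def PiE_def)
qed

lemma games_eqI:
  assumes "v \<in> carrier (games n)" "w \<in> carrier (games n)" "\<And>S. S \<subseteq> {1..n} \<Longrightarrow> v S = w S"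
  shows "v = w"
  using assms by (intro extensionalityI[of v "Pow {1..n}" w]) (auto simp: carrier_games)

lemma games_zero: "\<zero>\<^bsub>games n\<^esub> = (\<lambda>S\<in>Pow {1..n}. 0)"
  and games_add: "v \<oplus>\<^bsub>games n\<^esub> w = (\<lambda>S\<in>Pow {1..n}. v S + w S)"
  and games_smult: "c \<odot>\<^bsub>games n\<^esub> v = (\<lambda>S\<in>Pow {1..n}. c * v S)"
  by (simp_all add: games_def)

lemma games_add_apply: "S \<subseteq> {1..n} \<Longrightarrow> (v \<oplus>\<^bsub>games n\<^esub> w) S = v S + w S"
  and games_smult_apply: "S \<subseteq> {1..n} \<Longrightarrow> (c \<odot>\<^bsub>games n\<^esub> v) S = c * v S"
  by (simp_all add: games_add games_smult)

lemma module_games: "module real_field (games n)"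
proof (rule moduleI)
  show "cring real_field" ..
  show "abelian_group (games n)"
  proof (rule abelian_groupI)
    fix v assume v: "v \<in> carrier (games n)"
    show "\<exists>w\<in>carrier (games n). w \<oplus>\<^bsub>games n\<^esub> v = \<zero>\<^bsub>games n\<^esub>"
      using v by (intro bexI[of _ "\<lambda>S\<in>Pow {1..n}. - v S"])
        (auto simp: games_add games_zero carrier_games intro!: restrict_ext)
  qed (auto simp: games_add games_zero carrier_games restrict_def extensional_def)
qed (auto simp: games_add games_zero games_smult carrier_games restrict_def
      ring_of_type_algebra_def algebra_simps extensional_def)

lemma games_add_closed:
  "v \<in> carrier (games n) \<Longrightarrow> w \<in> carrier (games n) \<Longrightarrow> v \<oplus>\<^bsub>games n\<^esub> w \<in> carrier (games n)"
  and games_smult_closed: "v \<in> carrier (games n) \<Longrightarrow> c \<odot>\<^bsub>games n\<^esub> v \<in> carrier (games n)"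
  by (simp_all add: games_add games_smult carrier_games)

lemma vimage_permutes_subset: "\<sigma> permutes A \<Longrightarrow> S \<subseteq> A \<Longrightarrow> \<sigma> -` S \<subseteq> A"
  using permutes_in_image by fastforce

lemma games_act_apply:
  "v \<in> carrier (games n) \<Longrightarrow> S \<subseteq> {1..n} \<Longrightarrow> games_act n \<sigma> v S = v (\<sigma> -` S)"
  by (simp add: games_act_def)

lemma games_act_closed:
  "v \<in> carrier (games n) \<Longrightarrow> games_act n \<sigma> v \<in> carrier (games n)"
  by (auto simp: games_act_def carrier_games)

lemma games_act_id: "v \<in> carrier (games n) \<Longrightarrow> games_act n id v = v"
  by (rule games_eqI) (auto simp: games_act_apply games_act_closed)

text \<open>
  The action is a left one, because preimages reverse the order of composition: both sides
  take the value \<open>v (\<tau> -` (\<sigma> -` S))\<close> at \<open>S\<close>.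
\<close>

lemma games_act_comp:
  assumes "\<sigma> permutes {1..n}" "v \<in> carrier (games n)"
  shows "games_act n \<sigma> (games_act n \<tau> v) = games_act n (\<sigma> \<circ> \<tau>) v"
  using assms by (intro games_eqI[where n = n])
    (auto simp: games_act_apply games_act_closed vimage_permutes_subset vimage_comp)

lemma bij_betw_games_act:
  assumes "\<sigma> permutes {1..n}"
  shows "bij_betw (games_act n \<sigma>) (carrier (games n)) (carrier (games n))"
proof (rule bij_betw_byWitness[where f' = "games_act n (inv' \<sigma>)"])
  show "\<forall>v\<in>carrier (games n). games_act n (inv' \<sigma>) (games_act n \<sigma> v) = v"
    using assms by (simp add: games_act_comp permutes_inv permutes_inv_o games_act_id)
  show "\<forall>v\<in>carrier (games n). games_act n \<sigma> (games_act n (inv' \<sigma>) v) = v"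
    using assms by (simp add: games_act_comp permutes_inv_o games_act_id)
qed (auto intro: games_act_closed)

lemma group_action_games: "group_action (sym_group n) (carrier (games n)) (games_act n)"
proof -
  let ?E = "carrier (games n)"
  have Bij: "games_act n \<sigma> \<in> Bij ?E" if "\<sigma> permutes {1..n}" for \<sigma>
    using bij_betw_games_act[OF that] by (simp add: Bij_def) (simp add: games_act_def)
  have comp: "games_act n (\<sigma> \<circ> \<tau>) = compose ?E (games_act n \<sigma>) (games_act n \<tau>)"
    if "\<sigma> permutes {1..n}" "\<tau> permutes {1..n}" for \<sigma> \<tau>
  proof (rule extensionalityI[where A = ?E])
    show "games_act n (\<sigma> \<circ> \<tau>) \<in> extensional ?E" by (simp add: games_act_def)
  qed (use that in \<open>auto simp: compose_def games_act_comp\<close>)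
  have "games_act n \<in> hom (sym_group n) (BijGroup ?E)"
    using Bij comp by (auto simp: hom_def sym_group_def BijGroup_def)
  then show ?thesis
    by (simp add: group_action_def group_hom_def group_hom_axioms_def
        sym_group_is_group group_BijGroup)
qed

lemma games_act_linear:
  assumes "\<sigma> permutes {1..n}"
  shows "games_act n \<sigma> \<in> linear_maps (games n) (games n)"
  unfolding linear_maps_def
proof (intro CollectI conjI ballI allI)
  fix v w assume "v \<in> carrier (games n)" "w \<in> carrier (games n)"
  then show "games_act n \<sigma> (v \<oplus>\<^bsub>games n\<^esub> w) = games_act n \<sigma> v \<oplus>\<^bsub>games n\<^esub> games_act n \<sigma> w"
    using assms by (intro games_eqI[where n = n] games_act_closed games_add_closed)
      (simp_all add: games_act_apply games_add_closed games_add_apply vimage_permutes_subset)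
next
  fix c v assume "v \<in> carrier (games n)"
  then show "games_act n \<sigma> (c \<odot>\<^bsub>games n\<^esub> v) = c \<odot>\<^bsub>games n\<^esub> games_act n \<sigma> v"
    using assms by (intro games_eqI[where n = n])
      (simp_all add: games_act_closed games_smult_closed games_act_apply games_smult_apply vimage_permutes_subset)
qed (auto intro: games_act_closed)


section \<open>Positions in a composite and the composition formula\<close>

text \<open>
  After composition at \<open>i\<close> with a game of \<open>m\<close> players, the outer player \<open>x\<close> occupies position
  \<open>outer_pos m i x\<close> and the inner player \<open>y\<close> occupies position \<open>inner_pos i y\<close>. A player
  \<open>x > i\<close> moves by \<open>m - 1\<close>; the addition comes first because \<open>m\<close> may be 0.
\<close>

definition outer_pos :: "nat \<Rightarrow> nat \<Rightarrow> nat \<Rightarrow> nat" where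
  "outer_pos m i x = (if x < i then x else x + m - 1)"

definition inner_pos :: "nat \<Rightarrow> nat \<Rightarrow> nat" where
  "inner_pos i y = i + y - 1"

text \<open>
  The coalitions of outer and of inner players that a set \<open>S\<close> of positions stands for. The player
  \<open>i\<close> has been replaced, so it never belongs to the outer part.
\<close>

definition outer_part :: "nat \<Rightarrow> nat \<Rightarrow> nat \<Rightarrow> nat set \<Rightarrow> nat set" where
  "outer_part n m i S = {x \<in> {1..n} - {i}. outer_pos m i x \<in> S}"

definition inner_part :: "nat \<Rightarrow> nat \<Rightarrow> nat set \<Rightarrow> nat set" where
  "inner_part m i S = {y \<in> {1..m}. inner_pos i y \<in> S}"

lemma outer_part_subset: "outer_part n m i S \<subseteq> {1..n}"
  and inner_part_subset: "inner_part m i S \<subseteq> {1..m}"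
  by (auto simp: outer_part_def inner_part_def)

lemma insert_outer_part_subset: "i \<in> {1..n} \<Longrightarrow> insert i (outer_part n m i S) \<subseteq> {1..n}"
  using outer_part_subset by auto

lemma position_cases:
  assumes "i \<in> {1..n}" "z \<in> {1..n + m - 1}"
  obtains (outer) x where "x \<in> {1..n} - {i}" "z = outer_pos m i x"
    | (inner) y where "y \<in> {1..m}" "z = inner_pos i y"
proof -
  consider "z < i" | "i \<le> z" "z < i + m" | "i + m \<le> z" by linarith
  then show ?thesis
  proof cases
    case 1
    then show ?thesis using assms by (intro outer[of z]) (auto simp: outer_pos_def)
  next
    case 2
    then show ?thesis using assms by (intro inner[of "z + 1 - i"]) (auto simp: inner_pos_def)
  next
    case 3
    then show ?thesis using assms by (intro outer[of "z + 1 - m"]) (auto simp: outer_pos_def)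
  qed
qed

lemma bij_betw_positions:
  assumes "i \<in> {1..n}"
  shows "bij_betw (case_sum (outer_pos m i) (inner_pos i))
    (Inl ` ({1..n} - {i}) \<union> Inr ` {1..m}) {1..n + m - 1}"
  unfolding bij_betw_def
proof
  show "inj_on (case_sum (outer_pos m i) (inner_pos i)) (Inl ` ({1..n} - {i}) \<union> Inr ` {1..m})"
    using assms by (auto simp: inj_on_def outer_pos_def inner_pos_def split: if_splits)
  show "case_sum (outer_pos m i) (inner_pos i) ` (Inl ` ({1..n} - {i}) \<union> Inr ` {1..m})
      = {1..n + m - 1}"
  proof
    show "case_sum (outer_pos m i) (inner_pos i) ` (Inl ` ({1..n} - {i}) \<union> Inr ` {1..m})
        \<subseteq> {1..n + m - 1}"
      using assms by (auto simp: outer_pos_def inner_pos_def split: if_splits)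
    show "{1..n + m - 1} \<subseteq>
        case_sum (outer_pos m i) (inner_pos i) ` (Inl ` ({1..n} - {i}) \<union> Inr ` {1..m})"
    proof
      fix z assume "z \<in> {1..n + m - 1}"
      with assms show "z \<in> case_sum (outer_pos m i) (inner_pos i) ` (Inl ` ({1..n} - {i}) \<union> Inr ` {1..m})"
        by (cases rule: position_cases) (force simp: image_Un image_image)+
    qed
  qed
qed

text \<open>
  The four cases match the four clauses in the order relation of \<open>game_comp\<close>.
\<close>

lemma pos_le_pos_iff:
  assumes "i \<in> {1..n}"
  shows "x \<in> {1..n} - {i} \<Longrightarrow> x' \<in> {1..n} - {i} \<Longrightarrow> outer_pos m i x \<le> outer_pos m i x' \<longleftrightarrow> x \<le> x'"
    and "x \<in> {1..n} - {i} \<Longrightarrow> y \<in> {1..m} \<Longrightarrow> outer_pos m i x \<le> inner_pos i y \<longleftrightarrow> x \<le> i"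
    and "y \<in> {1..m} \<Longrightarrow> x \<in> {1..n} - {i} \<Longrightarrow> inner_pos i y \<le> outer_pos m i x \<longleftrightarrow> i \<le> x"
    and "y \<in> {1..m} \<Longrightarrow> y' \<in> {1..m} \<Longrightarrow> inner_pos i y \<le> inner_pos i y' \<longleftrightarrow> y \<le> y'"
  using assms by (auto simp: outer_pos_def inner_pos_def)

lemma pos_eq_pos_iff:
  assumes "i \<in> {1..n}"
  shows "x \<in> {1..n} - {i} \<Longrightarrow> x' \<in> {1..n} - {i} \<Longrightarrow> outer_pos m i x = outer_pos m i x' \<longleftrightarrow> x = x'"
    and "x \<in> {1..n} - {i} \<Longrightarrow> y \<in> {1..m} \<Longrightarrow> outer_pos m i x \<noteq> inner_pos i y"
    and "y \<in> {1..m} \<Longrightarrow> y' \<in> {1..m} \<Longrightarrow> inner_pos i y = inner_pos i y' \<longleftrightarrow> y = y'"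
  using assms by (auto simp: outer_pos_def inner_pos_def split: if_splits)

text \<open>
  A finite linear order has only one order isomorphism onto \<open>{1..N}\<close>, so every candidate for it
  computes the rank: the players up to \<open>x\<close> correspond to \<open>{1..f x}\<close>.
\<close>

lemma rank_eqI:
  assumes bij: "bij_betw f (players G) {1..N}"
    and mono: "\<And>x y. x \<in> players G \<Longrightarrow> y \<in> players G \<Longrightarrow> (x, y) \<in> prec G \<longleftrightarrow> f x \<le> f y"
    and x: "x \<in> players G"
  shows "rank G x = f x"
proof -
  have im: "f ` players G = {1..N}" and inj: "inj_on f (players G)"
    using bij by (auto simp: bij_betw_def)
  have "f ` {y \<in> players G. f y \<le> f x} = {1..f x}"
  proof -
    have "f ` {y \<in> players G. f y \<le> f x} = {z \<in> f ` players G. z \<le> f x}" by auto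
    also have "\<dots> = {1..f x}"
      using imageI[OF x, of f] unfolding im by auto
    finally show ?thesis .
  qed
  moreover have "inj_on f {y \<in> players G. f y \<le> f x}"
    using inj by (rule inj_on_subset) auto
  ultimately have "card {y \<in> players G. f y \<le> f x} = f x"
    by (metis card_image card_atLeastAtMost add_diff_cancel_right' Suc_eq_plus1)
  moreover have "{y \<in> players G. (y, x) \<in> prec G} = {y \<in> players G. f y \<le> f x}"
    using mono x by auto
  ultimately show ?thesis by (simp add: rank_def)
qed

lemma mem_map_prod_image: "inj f \<Longrightarrow> (f x, f y) \<in> map_prod f f ` R \<longleftrightarrow> (x, y) \<in> R"
  using inj_image_mem_iff[OF prod.inj_map, of f f "(x, y)" R] by simp

text \<open>
  The disjoint union, the gluing of the orders and the transport along the rank disappear in this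
  formula. The marginal contribution of \<open>i\<close> takes this form because \<open>i\<close> is not in the outer part.
\<close>

lemma games_circ_formula:
  assumes i: "i \<in> {1..n}"
  shows "games_circ n m i \<alpha> \<beta> = (\<lambda>S\<in>Pow {1..n + m - 1}.
    \<beta> {1..m} * \<alpha> (outer_part n m i S)
      + (\<alpha> (insert i (outer_part n m i S)) - \<alpha> (outer_part n m i S)) * \<beta> (inner_part m i S))"
proof -
  let ?A = "relabel Inl (interval_game n \<alpha>) :: (nat + nat) game"
  let ?B = "relabel Inr (interval_game m \<beta>) :: (nat + nat) game"
  let ?pos = "case_sum (outer_pos m i) (inner_pos i)"
  define C where "C = game_comp ?A (Inl i) ?B"
  have players: "players C = Inl ` ({1..n} - {i}) \<union> Inr ` {1..m}"
    by (auto simp: C_def game_comp_def relabel_def interval_game_def)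
  have precA: "(Inl x, Inl y) \<in> prec ?A \<longleftrightarrow> x \<in> {1..n} \<and> y \<in> {1..n} \<and> x \<le> y" for x y
    by (simp add: relabel_def interval_game_def mem_map_prod_image)
  have precB: "(Inr x, Inr y) \<in> prec ?B \<longleftrightarrow> x \<in> {1..m} \<and> y \<in> {1..m} \<and> x \<le> y" for x y
    by (simp add: relabel_def interval_game_def mem_map_prod_image)
  have playersA: "players ?A = Inl ` {1..n}" and playersB: "players ?B = Inr ` {1..m}"
    by (simp_all add: relabel_def interval_game_def)
  have prec: "(x, y) \<in> prec C \<longleftrightarrow> ?pos x \<le> ?pos y" if "x \<in> players C" "y \<in> players C" for x y
  proof -
    note prec_C = C_def game_comp_def game.select_convs playersA playersB
      Un_iff mem_Collect_eq case_prod_conv precA precB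
    have Inl_Inl: "(Inl a, Inl b) \<in> prec C \<longleftrightarrow> a \<le> b"
      if "a \<in> {1..n} - {i}" "b \<in> {1..n} - {i}" for a b
      using i that unfolding prec_C by (simp add: image_iff)
    have Inl_Inr: "(Inl a, Inr y) \<in> prec C \<longleftrightarrow> a \<le> i"
      and Inr_Inl: "(Inr y, Inl a) \<in> prec C \<longleftrightarrow> i \<le> a"
      if "a \<in> {1..n} - {i}" "y \<in> {1..m}" for a y
      using i that unfolding prec_C by (simp_all add: image_iff)
    have Inr_Inr: "(Inr y, Inr z) \<in> prec C \<longleftrightarrow> y \<le> z"
      if "y \<in> {1..m}" "z \<in> {1..m}" for y z
      using that unfolding prec_C by (simp add: image_iff)
    show ?thesis
      using that unfolding players
      by (elim UnE imageE) (simp_all only: sum.case Inl_Inl Inl_Inr Inr_Inl Inr_Inr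
          pos_le_pos_iff[OF i, where m = m])
  qed
  have bij: "bij_betw ?pos (players C) {1..n + m - 1}"
    unfolding players using i by (rule bij_betw_positions)
  have rank: "rank C x = ?pos x" if "x \<in> players C" for x
    using bij prec that by (rule rank_eqI)
  have image: "rank C ` players C = {1..n + m - 1}"
    using bij rank by (simp add: bij_betw_def cong: image_cong)
  have preimage: "{x \<in> players C. rank C x \<in> S} = {x \<in> players C. ?pos x \<in> S}" for S
    using rank by force
  have worth: "worth C T = \<beta> {1..m} * \<alpha> {x \<in> {1..n}. Inl x \<in> T}
      + (\<alpha> (insert i {x \<in> {1..n}. Inl x \<in> T}) - \<alpha> {x \<in> {1..n}. Inl x \<in> T})
        * \<beta> {y \<in> {1..m}. Inr y \<in> T}" if T: "T \<subseteq> players C" for T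
  proof -
    have sub: "T \<in> Pow (players ?A - {Inl i} \<union> players ?B)"
      using T unfolding players playersA playersB by auto
    have TA: "T \<inter> players ?A = Inl ` {x \<in> {1..n}. Inl x \<in> T}"
      and TB: "T \<inter> players ?B = Inr ` {y \<in> {1..m}. Inr y \<in> T}"
      unfolding playersA playersB by auto
    have del: "T \<inter> players ?A - {Inl i} = Inl ` {x \<in> {1..n}. Inl x \<in> T}"
      using T unfolding players playersA by auto
    \<comment> \<open>The worth of a relabelled game at an image is the original worth, because the tags
      \<open>Inl\<close> and \<open>Inr\<close> are injective.\<close>
    have wA: "worth ?A (Inl ` V) = \<alpha> V" if "V \<subseteq> {1..n}" for V
    proof -
      have "{x \<in> {1..n}. Inl x \<in> (Inl ` V :: (nat + nat) set)} = V" using that by auto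
      then show ?thesis using that by (simp add: relabel_def interval_game_def image_mono)
    qed
    have wB: "worth ?B (Inr ` V) = \<beta> V" if "V \<subseteq> {1..m}" for V
    proof -
      have "{x \<in> {1..m}. Inr x \<in> (Inr ` V :: (nat + nat) set)} = V" using that by auto
      then show ?thesis using that by (simp add: relabel_def interval_game_def image_mono)
    qed
    have ins: "T \<inter> players ?A \<union> {Inl i} = Inl ` insert i {x \<in> {1..n}. Inl x \<in> T}"
      unfolding TA by auto
    have "worth C T = worth ?B (players ?B) * worth ?A (T \<inter> players ?A)
        + (worth ?A (T \<inter> players ?A \<union> {Inl i}) - worth ?A (T \<inter> players ?A - {Inl i}))
          * worth ?B (T \<inter> players ?B)"
      using sub by (simp add: C_def game_comp_def marginal_def)
    also have "worth ?A (T \<inter> players ?A) = \<alpha> {x \<in> {1..n}. Inl x \<in> T}"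
      unfolding TA by (rule wA) auto
    also have "worth ?A (T \<inter> players ?A - {Inl i}) = \<alpha> {x \<in> {1..n}. Inl x \<in> T}"
      unfolding del by (rule wA) auto
    also have "worth ?A (T \<inter> players ?A \<union> {Inl i}) = \<alpha> (insert i {x \<in> {1..n}. Inl x \<in> T})"
      unfolding ins using i by (intro wA) auto
    also have "worth ?B (T \<inter> players ?B) = \<beta> {y \<in> {1..m}. Inr y \<in> T}"
      unfolding TB by (rule wB) auto
    also have "worth ?B (players ?B) = \<beta> {1..m}"
      unfolding playersB by (rule wB) auto
    finally show ?thesis .
  qed
  have "games_circ n m i \<alpha> \<beta> = worth (relabel (rank C) C)"
    by (simp only: games_circ_def C_def Let_def)
  also have "\<dots> = (\<lambda>S\<in>Pow {1..n + m - 1}. worth C {x \<in> players C. ?pos x \<in> S})"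
    unfolding relabel_def game.select_convs image preimage ..
  also have "\<dots> = (\<lambda>S\<in>Pow {1..n + m - 1}. \<beta> {1..m} * \<alpha> (outer_part n m i S)
      + (\<alpha> (insert i (outer_part n m i S)) - \<alpha> (outer_part n m i S)) * \<beta> (inner_part m i S))"
  proof (rule restrict_ext)
    fix S
    have "{x \<in> {1..n}. Inl x \<in> {z \<in> players C. ?pos z \<in> S}} = outer_part n m i S"
      and "{y \<in> {1..m}. Inr y \<in> {z \<in> players C. ?pos z \<in> S}} = inner_part m i S"
      by (auto simp: players outer_part_def inner_part_def)
    then show "worth C {x \<in> players C. ?pos x \<in> S} = \<beta> {1..m} * \<alpha> (outer_part n m i S)
      + (\<alpha> (insert i (outer_part n m i S)) - \<alpha> (outer_part n m i S)) * \<beta> (inner_part m i S)"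
      by (subst worth) auto
  qed
  finally show ?thesis .
qed

lemma games_circ_apply:
  assumes "i \<in> {1..n}" "S \<subseteq> {1..n + m - 1}"
  shows "games_circ n m i \<alpha> \<beta> S = \<beta> {1..m} * \<alpha> (outer_part n m i S)
    + (\<alpha> (insert i (outer_part n m i S)) - \<alpha> (outer_part n m i S)) * \<beta> (inner_part m i S)"
  using assms by (simp add: games_circ_formula)

lemma games_circ_closed:
  assumes "i \<in> {1..n}" "\<alpha> \<in> carrier (games n)" "\<beta> \<in> carrier (games m)"
  shows "games_circ n m i \<alpha> \<beta> \<in> carrier (games (n + m - 1))"
  using assms by (auto simp: games_circ_formula carrier_games outer_part_def inner_part_def)

lemma games_circ_bilinear:
  assumes "i \<in> {1..n}"
  shows "games_circ n m i \<in> bilinear_maps (games n) (games m) (games (n + m - 1))"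
proof -
  have sub: "outer_part n m i S \<subseteq> {1..n}" "insert i (outer_part n m i S) \<subseteq> {1..n}"
      "inner_part m i S \<subseteq> {1..m}" for S
    using outer_part_subset insert_outer_part_subset[OF assms] inner_part_subset by blast+
  note apply_simps = games_circ_apply[OF assms] games_add_apply games_smult_apply sub
  have "games_circ n m i \<alpha> \<in> linear_maps (games m) (games (n + m - 1))"
    if \<alpha>: "\<alpha> \<in> carrier (games n)" for \<alpha>
    unfolding linear_maps_def
  proof (intro CollectI conjI ballI allI funcsetI)
    fix v w assume vw: "v \<in> carrier (games m)" "w \<in> carrier (games m)"
    show "games_circ n m i \<alpha> (v \<oplus>\<^bsub>games m\<^esub> w)
        = games_circ n m i \<alpha> v \<oplus>\<^bsub>games (n + m - 1)\<^esub> games_circ n m i \<alpha> w"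
      by (rule games_eqI[OF games_circ_closed[OF assms \<alpha> games_add_closed[OF vw]]
            games_add_closed[OF games_circ_closed[OF assms \<alpha> vw(1)] games_circ_closed[OF assms \<alpha> vw(2)]]])
        (simp only: apply_simps order_refl, simp only: algebra_simps)
  next
    fix c v assume v: "v \<in> carrier (games m)"
    show "games_circ n m i \<alpha> (c \<odot>\<^bsub>games m\<^esub> v)
        = c \<odot>\<^bsub>games (n + m - 1)\<^esub> games_circ n m i \<alpha> v"
      by (rule games_eqI[OF games_circ_closed[OF assms \<alpha> games_smult_closed[OF v]]
            games_smult_closed[OF games_circ_closed[OF assms \<alpha> v]]])
        (simp only: apply_simps order_refl, simp only: algebra_simps)
  qed (intro games_circ_closed assms \<alpha>)
  moreover have "(\<lambda>\<alpha>. games_circ n m i \<alpha> \<beta>) \<in> linear_maps (games n) (games (n + m - 1))"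
    if \<beta>: "\<beta> \<in> carrier (games m)" for \<beta>
    unfolding linear_maps_def
  proof (intro CollectI conjI ballI allI funcsetI)
    fix v w assume vw: "v \<in> carrier (games n)" "w \<in> carrier (games n)"
    show "games_circ n m i (v \<oplus>\<^bsub>games n\<^esub> w) \<beta>
        = games_circ n m i v \<beta> \<oplus>\<^bsub>games (n + m - 1)\<^esub> games_circ n m i w \<beta>"
      by (rule games_eqI[OF games_circ_closed[OF assms games_add_closed[OF vw] \<beta>]
            games_add_closed[OF games_circ_closed[OF assms vw(1) \<beta>] games_circ_closed[OF assms vw(2) \<beta>]]])
        (simp only: apply_simps order_refl, simp only: algebra_simps)
  next
    fix c v assume v: "v \<in> carrier (games n)"
    show "games_circ n m i (c \<odot>\<^bsub>games n\<^esub> v) \<beta>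
        = c \<odot>\<^bsub>games (n + m - 1)\<^esub> games_circ n m i v \<beta>"
      by (rule games_eqI[OF games_circ_closed[OF assms games_smult_closed[OF v] \<beta>]
            games_smult_closed[OF games_circ_closed[OF assms v \<beta>]]])
        (simp only: apply_simps order_refl, simp only: algebra_simps)
  qed (intro games_circ_closed assms \<beta>)
  ultimately show ?thesis by (simp add: bilinear_maps_def)
qed


section \<open>Associativity\<close>

text \<open>
  Adding one position to a coalition enlarges exactly one of its two parts. These facts evaluate
  the marginal contributions in a composite.
\<close>

lemma parts_insert_inner_pos:
  assumes "i \<in> {1..n}" "y \<in> {1..m}"
  shows "outer_part n m i (insert (inner_pos i y) T) = outer_part n m i T"
    and "inner_part m i (insert (inner_pos i y) T) = insert y (inner_part m i T)"
  using assms(2) by (auto simp: outer_part_def inner_part_def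
      pos_eq_pos_iff[OF assms(1), where m = m] simp del: atLeastAtMost_iff One_nat_def)

lemma parts_insert_outer_pos:
  assumes "i \<in> {1..n}" "x \<in> {1..n} - {i}"
  shows "outer_part n m i (insert (outer_pos m i x) T) = insert x (outer_part n m i T)"
    and "inner_part m i (insert (outer_pos m i x) T) = inner_part m i T"
  using assms(2) by (auto simp: outer_part_def inner_part_def pos_eq_pos_iff[OF assms(1), where m = m]
      not_sym[OF pos_eq_pos_iff(2)[OF assms(1), where m = m]] simp del: atLeastAtMost_iff One_nat_def)

lemma parts_UNIV:
  assumes "i \<in> {1..n}"
  shows "outer_part n m i {1..n + m - 1} = {1..n} - {i}"
    and "inner_part m i {1..n + m - 1} = {1..m}"
  using assms by (auto simp: outer_part_def inner_part_def outer_pos_def inner_pos_def)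

text \<open>
  Both ways of nesting the three games place every player at the same position, so they cut a
  coalition into the same three pieces.
\<close>

lemma parts_sequential:
  assumes "i \<in> {1..p}" "j \<in> {1..q}"
  shows "outer_part p q i (outer_part (p + q - 1) r (i + j - 1) S) = outer_part p (q + r - 1) i S"
    and "inner_part q i (outer_part (p + q - 1) r (i + j - 1) S)
      = outer_part q r j (inner_part (q + r - 1) i S)"
    and "inner_part r (i + j - 1) S = inner_part r j (inner_part (q + r - 1) i S)"
proof -
  show "outer_part p q i (outer_part (p + q - 1) r (i + j - 1) S) = outer_part p (q + r - 1) i S"
  proof -
    have "outer_pos q i x \<in> {1..p + q - 1} - {i + j - 1} \<and>
        outer_pos r (i + j - 1) (outer_pos q i x) = outer_pos (q + r - 1) i x"
      if "x \<in> {1..p} - {i}" for x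
      using assms that by (auto simp: outer_pos_def)
    then show ?thesis unfolding outer_part_def by auto
  qed
  show "inner_part q i (outer_part (p + q - 1) r (i + j - 1) S)
      = outer_part q r j (inner_part (q + r - 1) i S)"
  proof -
    have "inner_pos i y \<in> {1..p + q - 1}"
      "inner_pos i y = i + j - 1 \<longleftrightarrow> y = j"
      "y \<noteq> j \<Longrightarrow> outer_pos r j y \<in> {1..q + r - 1}"
      "y \<noteq> j \<Longrightarrow> outer_pos r (i + j - 1) (inner_pos i y) = inner_pos i (outer_pos r j y)"
      if "y \<in> {1..q}" for y
      using assms that by (auto simp: outer_pos_def inner_pos_def)
    then show ?thesis unfolding outer_part_def inner_part_def by auto
  qed
  show "inner_part r (i + j - 1) S = inner_part r j (inner_part (q + r - 1) i S)"
  proof -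
    have "inner_pos j z \<in> {1..q + r - 1}"
      "inner_pos (i + j - 1) z = inner_pos i (inner_pos j z)"
      if "z \<in> {1..r}" for z
      using assms that by (auto simp: inner_pos_def)
    then show ?thesis unfolding inner_part_def by auto
  qed
qed

text \<open>
  With \<open>A\<close>, \<open>B\<close>, \<open>D\<close> the pieces of \<open>S\<close> in the three games, both sides equal
  \<open>v([r]) (u([q]) l(A) + l\<^sub>i(A) u(B)) + l\<^sub>i(A) u\<^sub>j(B) v(D)\<close>, where \<open>l\<^sub>i\<close> and \<open>u\<^sub>j\<close> are marginals.
\<close>

lemma games_sequential:
  assumes l: "l \<in> carrier (games p)" and u: "u \<in> carrier (games q)" and v: "v \<in> carrier (games r)"
    and i: "i \<in> {1..p}" and j: "j \<in> {1..q}"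
  shows "games_circ (p + q - 1) r (i + j - 1) (games_circ p q i l u) v
    = games_circ p (q + r - 1) i l (games_circ q r j u v)"
proof (rule games_eqI[where n = "p + q + r - 2"])
  have ij: "i + j - 1 \<in> {1..p + q - 1}" using i j by auto
  have arity: "p + q - 1 + r - 1 = p + q + r - 2" "p + (q + r - 1) - 1 = p + q + r - 2"
    using j by auto
  show "games_circ (p + q - 1) r (i + j - 1) (games_circ p q i l u) v \<in> carrier (games (p + q + r - 2))"
    using games_circ_closed[OF ij games_circ_closed[OF i l u] v] unfolding arity .
  show "games_circ p (q + r - 1) i l (games_circ q r j u v) \<in> carrier (games (p + q + r - 2))"
    using games_circ_closed[OF i l games_circ_closed[OF j u v]] unfolding arity .
  fix S assume S: "S \<subseteq> {1..p + q + r - 2}"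
  define A B D where "A = outer_part p (q + r - 1) i S"
    and "B = outer_part q r j (inner_part (q + r - 1) i S)"
    and "D = inner_part r (i + j - 1) S"
  define T where "T = outer_part (p + q - 1) r (i + j - 1) S"
  have T: "T \<subseteq> {1..p + q - 1}" "insert (i + j - 1) T \<subseteq> {1..p + q - 1}"
    using ij outer_part_subset unfolding T_def by auto
  have ins: "outer_part p q i (insert (i + j - 1) T) = A" "inner_part q i (insert (i + j - 1) T) = insert j B"
    using parts_insert_inner_pos[OF i j, of T] parts_sequential[OF i j, of r S]
    by (simp_all add: inner_pos_def T_def A_def B_def)
  have parts: "outer_part p q i T = A" "inner_part q i T = B"
    using parts_sequential[OF i j, of r S] by (simp_all add: T_def A_def B_def)
  have D: "inner_part r j (inner_part (q + r - 1) i S) = D"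
    using parts_sequential[OF i j, of r S] by (simp add: D_def)
  \<comment> \<open>The grand coalition has outer part \<open>{1..q} - {j}\<close>, whose worth under \<open>u\<close> cancels.\<close>
  have total: "games_circ q r j u v {1..q + r - 1} = u {1..q} * v {1..r}"
    unfolding games_circ_apply[OF j order_refl] parts_UNIV[OF j] insert_Diff[OF j]
    by (simp add: algebra_simps)
  have "games_circ (p + q - 1) r (i + j - 1) (games_circ p q i l u) v S
    = v {1..r} * (u {1..q} * l A + (l (insert i A) - l A) * u B)
      + (l (insert i A) - l A) * (u (insert j B) - u B) * v D"
    unfolding games_circ_apply[OF ij, of S r, unfolded arity, OF S] T_def[symmetric] D_def[symmetric]
      games_circ_apply[OF i T(1)] games_circ_apply[OF i T(2)] parts ins
    by (simp only: algebra_simps)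
  also have "\<dots> = games_circ p (q + r - 1) i l (games_circ q r j u v) S"
    unfolding games_circ_apply[OF i, of S "q + r - 1", unfolded arity, OF S] A_def[symmetric] total
      games_circ_apply[OF j inner_part_subset] B_def[symmetric] D
    by (simp only: algebra_simps)
  finally show "games_circ (p + q - 1) r (i + j - 1) (games_circ p q i l u) v S
    = games_circ p (q + r - 1) i l (games_circ q r j u v) S" .
qed

text \<open>
  Since \<open>i < k\<close>, inserting the block at \<open>i\<close> shifts position \<open>k\<close> to \<open>k + q - 1\<close>, whereas
  inserting the block at \<open>k\<close> leaves position \<open>i\<close> in place.
\<close>

lemma parts_parallel:
  assumes "1 \<le> i" "i < k" "k \<le> p"
  shows "outer_part p q i (outer_part (p + q - 1) r (k + q - 1) S)
      = outer_part p r k (outer_part (p + r - 1) q i S)"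
    and "inner_part q i (outer_part (p + q - 1) r (k + q - 1) S) = inner_part q i S"
    and "inner_part r k (outer_part (p + r - 1) q i S) = inner_part r (k + q - 1) S"
proof -
  show "outer_part p q i (outer_part (p + q - 1) r (k + q - 1) S)
      = outer_part p r k (outer_part (p + r - 1) q i S)"
  proof -
    have "outer_pos q i x \<in> {1..p + q - 1}" "outer_pos q i x = k + q - 1 \<longleftrightarrow> x = k"
      if "x \<in> {1..p} - {i}" for x
      using assms that by (auto simp: outer_pos_def)
    moreover have "outer_pos r k x \<in> {1..p + r - 1}" "outer_pos r k x = i \<longleftrightarrow> x = i"
      if "x \<in> {1..p} - {k}" for x
      using assms that by (auto simp: outer_pos_def)
    moreover have "outer_pos r (k + q - 1) (outer_pos q i x) = outer_pos q i (outer_pos r k x)"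
      if "x \<in> {1..p} - {i, k}" for x
      using assms that by (auto simp: outer_pos_def)
    ultimately show ?thesis unfolding outer_part_def by auto
  qed
  show "inner_part q i (outer_part (p + q - 1) r (k + q - 1) S) = inner_part q i S"
  proof -
    have "inner_pos i y \<in> {1..p + q - 1} - {k + q - 1}"
      "outer_pos r (k + q - 1) (inner_pos i y) = inner_pos i y" if "y \<in> {1..q}" for y
      using assms that by (auto simp: outer_pos_def inner_pos_def)
    then show ?thesis unfolding outer_part_def inner_part_def by auto
  qed
  show "inner_part r k (outer_part (p + r - 1) q i S) = inner_part r (k + q - 1) S"
  proof -
    have "inner_pos k z \<in> {1..p + r - 1} - {i}"
      "outer_pos q i (inner_pos k z) = inner_pos (k + q - 1) z" if "z \<in> {1..r}" for z
      using assms that by (auto simp: outer_pos_def inner_pos_def)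
    then show ?thesis unfolding outer_part_def inner_part_def by auto
  qed
qed

text \<open>
  The marginal of \<open>l \<circ>\<^sub>i u\<close> at \<open>k\<close> is \<open>u([q])\<close> times the first difference of \<open>l\<close> at \<open>k\<close> plus
  \<open>u(B)\<close> times the second difference of \<open>l\<close> at \<open>i\<close> and \<open>k\<close>. The resulting expression is
  unchanged when \<open>(i, u)\<close> and \<open>(k, v)\<close> are exchanged.
\<close>

lemma games_parallel:
  assumes l: "l \<in> carrier (games p)" and u: "u \<in> carrier (games q)" and v: "v \<in> carrier (games r)"
    and ik: "1 \<le> i" "i < k" "k \<le> p"
  shows "games_circ (p + q - 1) r (k + q - 1) (games_circ p q i l u) v
    = games_circ (p + r - 1) q i (games_circ p r k l v) u"
proof (rule games_eqI[where n = "p + q + r - 2"])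
  have i: "i \<in> {1..p}" "i \<in> {1..p + r - 1}" and k: "k \<in> {1..p}" "k + q - 1 \<in> {1..p + q - 1}"
    using ik by auto
  have arity: "p + q - 1 + r - 1 = p + q + r - 2" "p + r - 1 + q - 1 = p + q + r - 2"
    using ik by auto
  show "games_circ (p + q - 1) r (k + q - 1) (games_circ p q i l u) v \<in> carrier (games (p + q + r - 2))"
    using games_circ_closed[OF k(2) games_circ_closed[OF i(1) l u] v] unfolding arity .
  show "games_circ (p + r - 1) q i (games_circ p r k l v) u \<in> carrier (games (p + q + r - 2))"
    using games_circ_closed[OF i(2) games_circ_closed[OF k(1) l v] u] unfolding arity .
  fix S assume S: "S \<subseteq> {1..p + q + r - 2}"
  define T U where "T = outer_part (p + q - 1) r (k + q - 1) S"
    and "U = outer_part (p + r - 1) q i S"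
  define A B D where "A = outer_part p r k U"
    and "B = inner_part q i S" and "D = inner_part r (k + q - 1) S"
  have T: "T \<subseteq> {1..p + q - 1}" "insert (k + q - 1) T \<subseteq> {1..p + q - 1}"
    using k outer_part_subset unfolding T_def by auto
  have U: "U \<subseteq> {1..p + r - 1}" "insert i U \<subseteq> {1..p + r - 1}"
    using i outer_part_subset unfolding U_def by auto
  have parts: "outer_part p q i T = A" "inner_part q i T = B" "inner_part r k U = D"
    using parts_parallel[OF ik, where q = q and r = r and S = S] by (simp_all add: T_def U_def A_def B_def D_def)
  have "outer_pos q i k = k + q - 1" "outer_pos r k i = i"
    using ik by (simp_all add: outer_pos_def)
  then have ins: "outer_part p q i (insert (k + q - 1) T) = insert k A"
      "inner_part q i (insert (k + q - 1) T) = B"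
      "outer_part p r k (insert i U) = insert i A"
      "inner_part r k (insert i U) = D"
    using parts_insert_outer_pos[OF i(1), of k q T] parts_insert_outer_pos[OF k(1), of i r U] ik parts
    by (simp_all flip: A_def)
  have "games_circ (p + q - 1) r (k + q - 1) (games_circ p q i l u) v S
    = v {1..r} * (u {1..q} * l A + (l (insert i A) - l A) * u B)
      + (u {1..q} * (l (insert k A) - l A)
        + (l (insert i (insert k A)) - l (insert k A) - l (insert i A) + l A) * u B) * v D"
    unfolding games_circ_apply[OF k(2), of S r, unfolded arity, OF S] T_def[symmetric] D_def[symmetric]
      games_circ_apply[OF i(1) T(1)] games_circ_apply[OF i(1) T(2)] parts ins
    by (simp only: algebra_simps)
  also have "\<dots> = games_circ (p + r - 1) q i (games_circ p r k l v) u S"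
    unfolding games_circ_apply[OF i(2), of S q, unfolded arity, OF S] U_def[symmetric]
      A_def[symmetric] B_def[symmetric]
      games_circ_apply[OF k(1) U(1)] games_circ_apply[OF k(1) U(2)] parts ins insert_commute[of i k]
    by (simp only: algebra_simps)
  finally show "games_circ (p + q - 1) r (k + q - 1) (games_circ p q i l u) v S
    = games_circ (p + r - 1) q i (games_circ p r k l v) u S" .
qed


section \<open>Equivariance\<close>

text \<open>
  The hypotheses on \<open>\<pi>\<close> say that it moves positions as \<open>\<tau>\<close> and \<open>\<sigma>\<close> move players. Hence the
  parts of \<open>\<pi> -` S\<close> are the preimages of the parts of \<open>S\<close>, and the formula for the composite does
  the rest, with \<open>\<sigma>\<close> preserving the grand coalition. Since \<open>\<pi>\<close> fixes what is not a position,
  \<open>\<pi> -` S\<close> is again a set of positions.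
\<close>

lemma games_circ_equivariant:
  assumes l: "l \<in> carrier (games p)" and u: "u \<in> carrier (games q)" and i: "i \<in> {1..p}"
    and \<tau>: "\<tau> permutes {1..p}" and \<sigma>: "\<sigma> permutes {1..q}"
    and outer: "\<And>x. x \<in> {1..p} - {i} \<Longrightarrow> \<pi> (outer_pos q i x) = outer_pos q (\<tau> i) (\<tau> x)"
    and inner: "\<And>y. y \<in> {1..q} \<Longrightarrow> \<pi> (inner_pos i y) = inner_pos (\<tau> i) (\<sigma> y)"
    and fixed: "\<And>z. z \<notin> {1..p + q - 1} \<Longrightarrow> \<pi> z = z"
  shows "games_circ p q (\<tau> i) (games_act p \<tau> l) (games_act q \<sigma> u)
    = games_act (p + q - 1) \<pi> (games_circ p q i l u)"
proof (rule games_eqI[where n = "p + q - 1"])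
  have \<tau>i: "\<tau> i \<in> {1..p}" using permutes_in_image[OF \<tau>] i by blast
  show "games_circ p q (\<tau> i) (games_act p \<tau> l) (games_act q \<sigma> u) \<in> carrier (games (p + q - 1))"
    by (intro games_circ_closed games_act_closed l u \<tau>i)
  show "games_act (p + q - 1) \<pi> (games_circ p q i l u) \<in> carrier (games (p + q - 1))"
    by (intro games_circ_closed games_act_closed l u i)
  fix S assume S: "S \<subseteq> {1..p + q - 1}"
  have vimage: "\<pi> -` S \<subseteq> {1..p + q - 1}"
  proof
    fix z assume "z \<in> \<pi> -` S"
    then show "z \<in> {1..p + q - 1}"
      using S fixed[of z] unfolding vimage_eq by (metis subsetD)
  qed
  have \<tau>_eq: "\<tau> x = \<tau> i \<longleftrightarrow> x = i" for x
    using permutes_inj[OF \<tau>] by (rule inj_eq)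
  have outer_part: "\<tau> -` outer_part p q (\<tau> i) S = outer_part p q i (\<pi> -` S)"
  proof (rule Set.set_eqI)
    fix x
    have mem: "\<tau> x \<in> {1..p} - {\<tau> i} \<longleftrightarrow> x \<in> {1..p} - {i}"
      by (simp only: Diff_iff singleton_iff permutes_in_image[OF \<tau>] \<tau>_eq)
    show "x \<in> \<tau> -` outer_part p q (\<tau> i) S \<longleftrightarrow> x \<in> outer_part p q i (\<pi> -` S)"
      by (cases "x \<in> {1..p} - {i}") (simp_all only: outer_part_def vimage_eq mem_Collect_eq mem outer simp_thms)
  qed
  have inner_part: "\<sigma> -` inner_part q (\<tau> i) S = inner_part q i (\<pi> -` S)"
  proof (rule Set.set_eqI)
    fix y
    show "y \<in> \<sigma> -` inner_part q (\<tau> i) S \<longleftrightarrow> y \<in> inner_part q i (\<pi> -` S)"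
      by (cases "y \<in> {1..q}") (simp_all only: inner_part_def vimage_eq mem_Collect_eq
          permutes_in_image[OF \<sigma>] inner simp_thms)
  qed
  have ins: "\<tau> -` insert (\<tau> i) (outer_part p q (\<tau> i) S) = insert i (outer_part p q i (\<pi> -` S))"
    unfolding outer_part[symmetric] by (rule Set.set_eqI) (simp only: vimage_eq insert_iff \<tau>_eq)
  have full: "\<sigma> -` {1..q} = {1..q}"
    by (rule Set.set_eqI) (simp only: vimage_eq permutes_in_image[OF \<sigma>])
  show "games_circ p q (\<tau> i) (games_act p \<tau> l) (games_act q \<sigma> u) S
    = games_act (p + q - 1) \<pi> (games_circ p q i l u) S"
    unfolding games_circ_apply[OF \<tau>i S] games_act_apply[OF games_circ_closed[OF i l u] S]
      games_circ_apply[OF i vimage] games_act_apply[OF l outer_part_subset]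
      games_act_apply[OF l insert_outer_part_subset[OF \<tau>i]] games_act_apply[OF u inner_part_subset]
      games_act_apply[OF u order_refl] outer_part inner_part ins full ..
qed

lemma games_equivariant_inner:
  assumes l: "l \<in> carrier (games p)" and u: "u \<in> carrier (games q)" and i: "i \<in> {1..p}"
    and \<sigma>: "\<sigma> permutes {1..q}"
  shows "games_circ p q i l (games_act q \<sigma> u)
    = games_act (p + q - 1) (inner_perm i q \<sigma>) (games_circ p q i l u)"
proof -
  have "games_circ p q (id i) (games_act p id l) (games_act q \<sigma> u)
    = games_act (p + q - 1) (inner_perm i q \<sigma>) (games_circ p q i l u)"
  proof (rule games_circ_equivariant[OF l u i permutes_id \<sigma>])
    fix x assume "x \<in> {1..p} - {i}"
    then show "inner_perm i q \<sigma> (outer_pos q i x) = outer_pos q (id i) (id x)"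
      using i by (auto simp: inner_perm_def outer_pos_def)
  next
    fix y assume "y \<in> {1..q}"
    then have "inner_pos i y \<in> {i..<i + q}" "inner_pos i y + 1 - i = y"
      using i by (auto simp: inner_pos_def)
    then show "inner_perm i q \<sigma> (inner_pos i y) = inner_pos (id i) (\<sigma> y)"
      using i by (simp only: inner_perm_def if_True) (simp add: inner_pos_def)
  next
    fix z assume "z \<notin> {1..p + q - 1}"
    then show "inner_perm i q \<sigma> z = z"
      using i by (auto simp: inner_perm_def)
  qed
  then show ?thesis using l by (simp add: games_act_id)
qed

text \<open>
  Before a block \<open>k > i\<close> there are \<open>k - 2\<close> blocks of size 1 and the wide block \<open>i\<close>.
\<close>

lemma block_offset_one_wide:
  assumes "1 \<le> i" "1 \<le> k"
  shows "block_offset (\<lambda>l. if l = i then q else 1) k = (if k \<le> i then k - 1 else k + q - 2)"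
  using \<open>1 \<le> k\<close>
proof (induction k rule: dec_induct)
  case base
  then show ?case using \<open>1 \<le> i\<close> by (simp add: block_offset_def)
next
  case (step k)
  then have "block_offset (\<lambda>l. if l = i then q else 1) (Suc k)
      = block_offset (\<lambda>l. if l = i then q else 1) k + (if k = i then q else 1)"
    by (simp add: block_offset_def)
  then show ?case using step \<open>1 \<le> i\<close> by auto
qed

text \<open>
  When only the \<open>i\<close>-th block has a size different from 1, the blocks are the sets of positions
  that the players of a composite occupy. This identifies \<^const>\<open>block_perm\<close> with the map that a
  permutation of the outer players induces on positions.
\<close>

lemma block_one_wide:
  assumes "1 \<le> i" "1 \<le> k"
  shows "block (\<lambda>l. if l = i then q else 1) k
    = (if k = i then inner_pos i ` {1..q} else {outer_pos q i k})"
proof -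
  have "{i - 1<..i - 1 + q} = inner_pos i ` {1..q}"
  proof
    show "{i - 1<..i - 1 + q} \<subseteq> inner_pos i ` {1..q}"
    proof
      fix z assume "z \<in> {i - 1<..i - 1 + q}"
      then show "z \<in> inner_pos i ` {1..q}"
        using assms by (intro image_eqI[of _ _ "z + 1 - i"]) (auto simp: inner_pos_def)
    qed
  qed (use assms in \<open>auto simp: inner_pos_def\<close>)
  then show ?thesis
    using assms by (auto simp: block_def block_offset_one_wide[OF assms] outer_pos_def)
qed

lemma block_perm_in_block:
  assumes i: "i \<in> {1..p}" and k: "k \<in> {1..p}"
    and z: "z \<in> block (\<lambda>l. if l = i then q else 1) k"
  shows "block_perm p (\<lambda>l. if l = i then q else 1) \<tau> z
    = block_offset ((\<lambda>l. if l = i then q else 1) \<circ> inv' \<tau>) (\<tau> k)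
      + (z - block_offset (\<lambda>l. if l = i then q else 1) k)"
proof -
  let ?s = "\<lambda>l. if l = i then q else (1::nat)"
  have "(THE k. k \<in> {1..p} \<and> z \<in> block ?s k) = k"
  proof (rule the_equality)
    fix k' assume k': "k' \<in> {1..p} \<and> z \<in> block ?s k'"
    have "block ?s k = (if k = i then inner_pos i ` {1..q} else {outer_pos q i k})"
      "block ?s k' = (if k' = i then inner_pos i ` {1..q} else {outer_pos q i k'})"
      using i k k' by (auto simp only: atLeastAtMost_iff intro!: block_one_wide)
    then show "k' = k"
      using z k' i k by (auto simp: inner_pos_def outer_pos_def split: if_splits)
  qed (use k z in simp)
  moreover have "\<exists>k\<in>{1..p}. z \<in> block ?s k" using k z by blast
  ultimately show ?thesis unfolding block_perm_def by (simp only: if_True Let_def)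
qed

lemma games_equivariant_outer:
  assumes l: "l \<in> carrier (games p)" and u: "u \<in> carrier (games q)" and i: "i \<in> {1..p}"
    and \<tau>: "\<tau> permutes {1..p}"
  shows "games_circ p q (\<tau> i) (games_act p \<tau> l) u
    = games_act (p + q - 1) (block_perm p (\<lambda>k. if k = i then q else 1) \<tau>) (games_circ p q i l u)"
proof -
  let ?s = "\<lambda>k. if k = i then q else (1::nat)"
  have \<tau>_mem: "\<tau> x \<in> {1..p}" if "x \<in> {1..p}" for x
    using permutes_in_image[OF \<tau>] that by blast
  \<comment> \<open>In the permuted division the wide block is the one numbered \<open>\<tau> i\<close>.\<close>
  have perm_s: "?s \<circ> inv' \<tau> = (\<lambda>k. if k = \<tau> i then q else 1)"
    using permutes_inv_eq[OF \<tau>] by (auto simp: fun_eq_iff)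
  have "games_circ p q (\<tau> i) (games_act p \<tau> l) (games_act q id u)
    = games_act (p + q - 1) (block_perm p ?s \<tau>) (games_circ p q i l u)"
  proof (rule games_circ_equivariant[OF l u i \<tau> permutes_id])
    fix x assume x: "x \<in> {1..p} - {i}"
    have "\<tau> x \<noteq> \<tau> i" using x permutes_inj[OF \<tau>] by (auto simp: inj_eq)
    have "block_perm p ?s \<tau> (outer_pos q i x)
      = block_offset (\<lambda>k. if k = \<tau> i then q else 1) (\<tau> x) + (outer_pos q i x - block_offset ?s x)"
      unfolding perm_s[symmetric] using i x by (intro block_perm_in_block) (auto simp: block_one_wide)
    also have "\<dots> = outer_pos q (\<tau> i) (\<tau> x)"
      using x i \<tau>_mem[of x] \<tau>_mem[of i] \<open>\<tau> x \<noteq> \<tau> i\<close>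
      by (auto simp: block_offset_one_wide outer_pos_def)
    finally show "block_perm p ?s \<tau> (outer_pos q i x) = outer_pos q (\<tau> i) (\<tau> x)" .
  next
    fix y assume y: "y \<in> {1..q}"
    have "block_perm p ?s \<tau> (inner_pos i y)
      = block_offset (\<lambda>k. if k = \<tau> i then q else 1) (\<tau> i) + (inner_pos i y - block_offset ?s i)"
      unfolding perm_s[symmetric] using i y by (intro block_perm_in_block) (auto simp: block_one_wide)
    also have "\<dots> = inner_pos (\<tau> i) (id y)"
      using y i \<tau>_mem[of i] by (auto simp: block_offset_one_wide inner_pos_def)
    finally show "block_perm p ?s \<tau> (inner_pos i y) = inner_pos (\<tau> i) (id y)" .
  next
    fix z assume z: "z \<notin> {1..p + q - 1}"
    have "z \<notin> block ?s k" if k: "k \<in> {1..p}" for k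
    proof -
      have "block ?s k = (if k = i then inner_pos i ` {1..q} else {outer_pos q i k})"
        using i k by (intro block_one_wide) auto
      moreover have "inner_pos i ` {1..q} \<subseteq> {1..p + q - 1}"
        using i by (auto simp: inner_pos_def)
      moreover have "k \<noteq> i \<Longrightarrow> outer_pos q i k \<in> {1..p + q - 1}"
        using i k by (auto simp: outer_pos_def)
      ultimately show ?thesis using z by (metis singletonD subsetD)
    qed
    then show "block_perm p ?s \<tau> z = z" unfolding block_perm_def by (metis (no_types, lifting))
  qed
  then show ?thesis using u by (simp add: games_act_id)
qed


section \<open>The unit\<close>

lemma games_unit_closed: "games_unit c \<in> carrier (games 1)"
  by (auto simp: games_unit_def games_smult carrier_games trivial_game_def)

lemma games_unit_one_values: "games_unit 1 {} = 0" "games_unit 1 {1} = 1"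
  by (simp_all add: games_unit_def games_smult trivial_game_def)

lemma games_unit_linear: "games_unit \<in> linear_maps real_line (games 1)"
  using games_unit_closed
  by (auto simp: linear_maps_def real_line_def ring.defs module.defs ring_of_type_algebra_def
      games_unit_def games_smult games_add algebra_simps intro!: restrict_ext)

text \<open>
  The outer part of \<open>S\<close> is \<open>S - {i}\<close>, and the unit game contributes the marginal of \<open>i\<close> exactly
  when \<open>i \<in> S\<close>; the sum is \<open>u S\<close> in both cases.
\<close>

lemma games_unit_right:
  assumes u: "u \<in> carrier (games n)" and i: "i \<in> {1..n}"
  shows "games_circ n 1 i u (games_unit 1) = u"
proof (rule games_eqI[where n = n])
  show "games_circ n 1 i u (games_unit 1) \<in> carrier (games n)"
    using games_circ_closed[OF i u games_unit_closed[of 1]] by simp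
  fix S assume S: "S \<subseteq> {1..n}"
  have outer: "outer_part n 1 i S = S - {i}"
    using S by (auto simp: outer_part_def outer_pos_def)
  have inner: "inner_part 1 i S = (if i \<in> S then {1} else {})"
    by (auto simp: inner_part_def inner_pos_def)
  show "games_circ n 1 i u (games_unit 1) S = u S"
    using S by (subst games_circ_apply[OF i])
      (auto simp: outer inner games_unit_one_values insert_absorb simp del: One_nat_def)
qed (rule u)

text \<open>
  The one outer player is replaced, so the outer part is empty; its marginal contribution to the
  unit game is 1, and the formula reduces to \<open>u S\<close>.
\<close>

lemma games_unit_left:
  assumes u: "u \<in> carrier (games n)"
  shows "games_circ 1 n 1 (games_unit 1) u = u"
proof (rule games_eqI[where n = n])
  show "games_circ 1 n 1 (games_unit 1) u \<in> carrier (games n)"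
    using games_circ_closed[of 1 1, OF _ games_unit_closed[of 1] u] by simp
  fix S assume S: "S \<subseteq> {1..n}"
  have outer: "outer_part 1 n 1 S = {}"
    by (auto simp: outer_part_def)
  have inner: "inner_part n 1 S = S"
    using S by (auto simp: inner_part_def inner_pos_def)
  show "games_circ 1 n 1 (games_unit 1) u S = u S"
    using S by (subst games_circ_apply) (auto simp: outer inner games_unit_one_values simp del: One_nat_def)
qed (rule u)

theorem theorem1:
  shows "unital_partial_operad games games_act games_circ games_unit"
proof (intro unital_partial_operad.intro S_module.intro unital_partial_operad_axioms.intro)
  show "module real_field (games n)" for n by (rule module_games)
  show "group_action (sym_group n) (carrier (games n)) (games_act n)" for n
    by (rule group_action_games)
  show "games_act n \<sigma> \<in> linear_maps (games n) (games n)"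
    if "\<sigma> \<in> carrier (sym_group n)" for n \<sigma>
    using that unfolding sym_group_carrier by (rule games_act_linear)
next
  fix l u v \<sigma> \<tau> and p q r i j k :: nat
  assume lu: "l \<in> carrier (games p)" "u \<in> carrier (games q)"
  {
    assume "v \<in> carrier (games r)" "i \<in> {1..p}" "j \<in> {1..q}"
    then show "games_circ (p + q - 1) r (i + j - 1) (games_circ p q i l u) v
        = games_circ p (q + r - 1) i l (games_circ q r j u v)"
      by (rule games_sequential[OF lu])
  next
    assume "v \<in> carrier (games r)" "1 \<le> i" "i < k" "k \<le> p"
    then show "games_circ (p + q - 1) r (k + q - 1) (games_circ p q i l u) v
        = games_circ (p + r - 1) q i (games_circ p r k l v) u"
      by (rule games_parallel[OF lu])
  next
    assume "i \<in> {1..p}" "\<sigma> \<in> carrier (sym_group q)"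
    then show "games_circ p q i l (games_act q \<sigma> u)
        = games_act (p + q - 1) (inner_perm i q \<sigma>) (games_circ p q i l u)"
      unfolding sym_group_carrier by (rule games_equivariant_inner[OF lu])
  next
    assume "i \<in> {1..p}" "\<tau> \<in> carrier (sym_group p)"
    then show "games_circ p q (\<tau> i) (games_act p \<tau> l) u
        = games_act (p + q - 1) (block_perm p (\<lambda>k. if k = i then q else 1) \<tau>) (games_circ p q i l u)"
      unfolding sym_group_carrier by (rule games_equivariant_outer[OF lu])
  }
qed (fact games_circ_bilinear games_unit_linear games_unit_right games_unit_left)+

end
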